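(* Let $1\le p<\infty$ and let $(\Omega,\Sigma,\mu)$ be a $\sigma$-finite measure space such that $L_p(\mu)$ is infinite-dimensional. Then, for every $n\in\mathbb{N}$, $n\ge1$, $$\Theta_{L_p(\mu)}(n)\le n^{-1/p},$$ where $\Theta_{L_p(\mu)}(n)$ is the covering index of $L_p(\mu)$ at level $n$.
   Context: $L_p(\mu)$ is the usual scalar-valued Lebesgue space over $\mathbb{K}=\mathbb{R}$ or $\mathbb{C}$; $B_X$ denotes the closed unit ball of a Banach space $X$. Essential inradius: for a set $A\subset X$, $$\varrho(A)=\sup\{r>0:\ \exists x\in A\ \exists Y\le X \text{ a closed subspace with } \dim X/Y<\infty,\ \dim Y=\infty,\ x+r(B_X\cap Y)\subset A\},$$ with the convention $\sup\varnothing=0$. Covering index: let $\mathcal{C}(X)$ be the family of closed, convex, bounded subsets of $X$. For $n\ge 1$, $$\Theta_X(n)=\inf\Bigl\{\max_{1\le k\le n}\varrho(A_k):\ A_1,\dots,A_n\in\mathcal{C}(X),\ B_X=\bigcup_{k=1}^n A_k\Bigr\}.$$ *)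

theory Defs
  imports "HOL-Analysis.Analysis"
begin

text \<open>
  \<open>L_p(\<mu>)\<close> depends on the values \<open>\<mu>\<close> and \<open>p\<close>, so it cannot be a type of class
  \<^class>\<open>real_normed_vector\<close>. Normed spaces over a scalar field \<open>'k\<close> are therefore records
  with an explicit carrier.
\<close>

record ('k, 'v) nspace =
  carrier :: "'v set"
  zero :: "'v"
  add :: "'v \<Rightarrow> 'v \<Rightarrow> 'v"
  scale :: "'k \<Rightarrow> 'v \<Rightarrow> 'v"
  vnorm :: "'v \<Rightarrow> real"

definition subspace_of :: "'v set \<Rightarrow> ('k, 'v) nspace \<Rightarrow> bool" where
  "subspace_of Y X \<longleftrightarrow> Y \<subseteq> carrier X \<and> zero X \<in> Y \<and>
     (\<forall>x\<in>Y. \<forall>y\<in>Y. add X x y \<in> Y) \<and> (\<forall>c. \<forall>x\<in>Y. scale X c x \<in> Y)"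

definition lin_span :: "('k, 'v) nspace \<Rightarrow> 'v set \<Rightarrow> 'v set" where
  "lin_span X F = \<Inter> {Y. subspace_of Y X \<and> F \<subseteq> Y}"

definition finite_dim :: "('k, 'v) nspace \<Rightarrow> bool" where
  "finite_dim X \<longleftrightarrow> (\<exists>F. finite F \<and> F \<subseteq> carrier X \<and> lin_span X F = carrier X)"

definition coset :: "('k, 'v) nspace \<Rightarrow> 'v set \<Rightarrow> 'v \<Rightarrow> 'v set" where
  "coset X Y x = add X x ` Y"

text \<open>
  In \<open>X/Y\<close> the scalar multiple of a coset \<open>A\<close> is \<open>c A + Y\<close>; the summand \<open>Y\<close> matters only for
  \<open>c = 0\<close>, where \<open>c A\<close> alone would be \<open>{0}\<close> instead of \<open>Y\<close>. The norm is the quotient norm.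
\<close>

definition quotient_space :: "('k, 'v) nspace \<Rightarrow> 'v set \<Rightarrow> ('k, 'v set) nspace" where
  "quotient_space X Y =
     \<lparr>carrier = coset X Y ` carrier X,
      zero = Y,
      add = (\<lambda>A B. {add X a b | a b. a \<in> A \<and> b \<in> B}),
      scale = (\<lambda>c A. {add X (scale X c a) y | a y. a \<in> A \<and> y \<in> Y}),
      vnorm = (\<lambda>A. Inf (vnorm X ` A))\<rparr>"

text \<open>
  \<^locale>\<open>Metric_space\<close> requires symmetry and nonnegativity on the whole type, hence the value
  \<open>0\<close> outside the carrier.
\<close>

definition ndist :: "('k::real_normed_field, 'v) nspace \<Rightarrow> 'v \<Rightarrow> 'v \<Rightarrow> real" where
  "ndist X x y =
     (if x \<in> carrier X \<and> y \<in> carrier X then vnorm X (add X x (scale X (-1) y)) else 0)"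

definition closed_subset :: "('k::real_normed_field, 'v) nspace \<Rightarrow> 'v set \<Rightarrow> bool" where
  "closed_subset X A \<longleftrightarrow> closedin (Metric_space.mtopology (carrier X) (ndist X)) A"

definition bounded_subset :: "('k, 'v) nspace \<Rightarrow> 'v set \<Rightarrow> bool" where
  "bounded_subset X A \<longleftrightarrow> A \<subseteq> carrier X \<and> (\<exists>C. \<forall>x\<in>A. vnorm X x \<le> C)"

definition convex_subset :: "('k::real_normed_field, 'v) nspace \<Rightarrow> 'v set \<Rightarrow> bool" where
  "convex_subset X A \<longleftrightarrow> A \<subseteq> carrier X \<and>
     (\<forall>x\<in>A. \<forall>y\<in>A. \<forall>t\<in>{0..1}.
        add X (scale X (of_real (1 - t)) x) (scale X (of_real t) y) \<in> A)"

definition unit_ball :: "('k, 'v) nspace \<Rightarrow> 'v set" where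
  "unit_ball X = {x \<in> carrier X. vnorm X x \<le> 1}"

text \<open>
  The supremum and infimum below are taken in \<^typ>\<open>ennreal\<close>, where \<open>Sup {} = 0\<close>.
\<close>

definition essential_inradius :: "('k::real_normed_field, 'v) nspace \<Rightarrow> 'v set \<Rightarrow> ennreal" where
  "essential_inradius X A =
     Sup {ennreal r | r. r > 0 \<and>
       (\<exists>x\<in>A. \<exists>Y. subspace_of Y X \<and> closed_subset X Y \<and>
          finite_dim (quotient_space X Y) \<and> \<not> finite_dim (X\<lparr>carrier := Y\<rparr>) \<and>
          {add X x (scale X (of_real r) y) | y. y \<in> unit_ball X \<inter> Y} \<subseteq> A)}"

definition closed_convex_bounded :: "('k::real_normed_field, 'v) nspace \<Rightarrow> 'v set set" where
  "closed_convex_bounded X = {A. closed_subset X A \<and> convex_subset X A \<and> bounded_subset X A}"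

definition covering_index :: "('k::real_normed_field, 'v) nspace \<Rightarrow> nat \<Rightarrow> ennreal" where
  "covering_index X n =
     Inf {MAX k\<in>{1..n}. essential_inradius X (A k) | A.
       (\<forall>k\<in>{1..n}. A k \<in> closed_convex_bounded X) \<and> unit_ball X = (\<Union>k\<in>{1..n}. A k)}"

definition Lp_functions :: "'a measure \<Rightarrow> real \<Rightarrow> ('k::real_normed_field, 'a \<Rightarrow> 'k) nspace" where
  "Lp_functions M p =
     \<lparr>carrier = {f \<in> borel_measurable M. integrable M (\<lambda>x. norm (f x) powr p)},
      zero = (\<lambda>x. 0),
      add = (\<lambda>f g x. f x + g x),
      scale = (\<lambda>c f x. c * f x),
      vnorm = (\<lambda>f. (\<integral>x. norm (f x) powr p \<partial>M) powr (1 / p))\<rparr>"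

definition Lp_null :: "'a measure \<Rightarrow> ('a \<Rightarrow> 'k::real_normed_field) set" where
  "Lp_null M = {f \<in> borel_measurable M. AE x in M. f x = 0}"

text \<open>The first argument only selects the scalar field.\<close>

definition Lp ::
  "'k::real_normed_field itself \<Rightarrow> 'a measure \<Rightarrow> real \<Rightarrow> ('k, ('a \<Rightarrow> 'k) set) nspace" where
  "Lp _ M p = quotient_space (Lp_functions M p) (Lp_null M)"

text \<open>
  The elements of \<^const>\<open>Lp\<close> are the classes of almost everywhere equal functions, and the
  quotient norm of a class is the common value of the \<open>p\<close>-norm on it.
\<close>

lemma coset_Lp_null:
  fixes f :: "'a \<Rightarrow> 'k::{real_normed_field, second_countable_topology}"
  assumes f: "f \<in> carrier (Lp_functions M p)"
  shows "coset (Lp_functions M p) (Lp_null M) f =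
    {g \<in> carrier (Lp_functions M p). AE x in M. g x = f x}"
proof (intro set_eqI iffI)
  fix g assume "g \<in> coset (Lp_functions M p) (Lp_null M) f"
  then obtain h where h: "h \<in> borel_measurable M" "AE x in M. h x = 0" and g: "g = (\<lambda>x. f x + h x)"
    by (auto simp: coset_def Lp_functions_def Lp_null_def)
  have fm: "f \<in> borel_measurable M" and fi: "integrable M (\<lambda>x. norm (f x) powr p)"
    using f by (auto simp: Lp_functions_def)
  have gm: "g \<in> borel_measurable M" unfolding g using fm h(1) by measurable
  have ae: "AE x in M. g x = f x" using h(2) by eventually_elim (simp add: g)
  have "integrable M (\<lambda>x. norm (g x) powr p)"
  proof (rule integrable_cong_AE_imp[OF fi])
    show "(\<lambda>x. norm (g x) powr p) \<in> borel_measurable M" using gm by measurable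
    show "AE x in M. norm (f x) powr p = norm (g x) powr p" using ae by eventually_elim simp
  qed
  then show "g \<in> {g \<in> carrier (Lp_functions M p). AE x in M. g x = f x}"
    using gm ae by (simp add: Lp_functions_def)
next
  fix g assume g: "g \<in> {g \<in> carrier (Lp_functions M p). AE x in M. g x = f x}"
  define h where "h = (\<lambda>x. g x - f x)"
  have gm: "g \<in> borel_measurable M" and fm: "f \<in> borel_measurable M"
    using f g by (auto simp: Lp_functions_def)
  have "h \<in> borel_measurable M" unfolding h_def using gm fm by measurable
  moreover have "AE x in M. h x = 0" using g by (auto simp: h_def)
  moreover have "g = add (Lp_functions M p) f h" by (simp add: Lp_functions_def h_def)
  ultimately show "g \<in> coset (Lp_functions M p) (Lp_null M) f"
    by (auto simp: coset_def Lp_null_def)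
qed

lemma vnorm_Lp:
  fixes f :: "'a \<Rightarrow> 'k::{real_normed_field, second_countable_topology}"
  assumes f: "f \<in> carrier (Lp_functions M p)"
  shows "vnorm (Lp TYPE('k) M p) (coset (Lp_functions M p) (Lp_null M) f) =
    (\<integral>x. norm (f x) powr p \<partial>M) powr (1 / p)"
proof -
  let ?N = "\<lambda>g::'a \<Rightarrow> 'k. (\<integral>x. norm (g x) powr p \<partial>M) powr (1 / p)"
  let ?C = "coset (Lp_functions M p) (Lp_null M) f"
  have "?N g = ?N f" if "g \<in> ?C" for g
  proof -
    have g: "g \<in> carrier (Lp_functions M p)" "AE x in M. g x = f x"
      using that by (auto simp: coset_Lp_null[OF f])
    have "(\<integral>x. norm (g x) powr p \<partial>M) = (\<integral>x. norm (f x) powr p \<partial>M)"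
    proof (rule integral_cong_AE)
      show "(\<lambda>x. norm (g x) powr p) \<in> borel_measurable M"
        "(\<lambda>x. norm (f x) powr p) \<in> borel_measurable M"
        using f g(1) by (auto simp: Lp_functions_def)
      show "AE x in M. norm (g x) powr p = norm (f x) powr p"
        using g(2) by eventually_elim simp
    qed
    then show ?thesis by simp
  qed
  moreover have "f \<in> ?C" using f by (simp add: coset_Lp_null[OF f])
  ultimately have "?N ` ?C = {?N f}" by blast
  moreover have "vnorm (Lp TYPE('k) M p) ?C = Inf (?N ` ?C)"
    unfolding Lp_def quotient_space_def by (simp only: nspace.simps) (simp add: Lp_functions_def)
  ultimately show ?thesis by simp
qed

end

theory Submission
  imports Defs
begin

text \<open>
  If \<open>L_p(\<mu>)\<close> is infinite-dimensional, there are disjoint measurable sets \<open>F_1, \<dots>, F_n\<close>, each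
  containing infinitely many disjoint sets that carry a nonzero \<open>L_p\<close> function. Since the \<open>p\<close>-th
  powers of the norms over the \<open>F_k\<close> add up to at most \<open>1\<close> on the unit ball, the ball is covered
  by the sets \<open>A_k = {f. \<parallel>f\<parallel> \<le> 1 \<and> \<parallel>f 1_{F_k}\<parallel> \<le> n^{-1/p}}\<close>. A subspace of finite codimension
  contains a unit vector \<open>y\<close> supported in \<open>F_k\<close>, so \<open>x + r y, x - r y \<in> A_k\<close> forces
  \<open>r \<le> n^{-1/p}\<close> by the triangle inequality for the seminorm over \<open>F_k\<close>.
\<close>

subsection \<open>Images of function spaces\<close>

text \<open>Gaussian elimination by induction on the set of equations: an equation \<open>j0\<close>
  without nonzero coefficients is vacuous; otherwise it serves to eliminate one unknown
  \<open>i0\<close> from the others, which costs one equation and one unknown.\<close>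

lemma underdetermined_homogeneous_system:
  fixes a :: "'i \<Rightarrow> 'j \<Rightarrow> 'k::field"
  assumes "finite J" "finite I" "card J < card I"
  shows "\<exists>c. (\<exists>i\<in>I. c i \<noteq> 0) \<and> (\<forall>j\<in>J. (\<Sum>i\<in>I. c i * a i j) = 0)"
  using assms
proof (induction J arbitrary: I a rule: finite_induct)
  case empty
  then have "I \<noteq> {}" by auto
  then show ?case by (intro exI[of _ "\<lambda>_. 1"]) auto
next
  case (insert j0 J)
  have card: "card J < card I" using insert by simp
  show ?case
  proof (cases "\<forall>i\<in>I. a i j0 = 0")
    case True
    then show ?thesis using insert.IH[OF insert.prems(1) card, of a] by (auto intro!: sum.neutral)
  next
    case False
    then obtain i0 where i0: "i0 \<in> I" "a i0 j0 \<noteq> 0" by blast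
    define I' where "I' = I - {i0}"
    have I': "finite I'" "i0 \<notin> I'" "I = insert i0 I'" "card J < card I'"
      using insert i0 by (auto simp: I'_def)
    obtain c where c: "\<exists>i\<in>I'. c i \<noteq> 0"
      "\<forall>j\<in>J. (\<Sum>i\<in>I'. c i * (a i j - a i j0 / a i0 j0 * a i0 j)) = 0"
      using insert.IH[OF I'(1,4), of "\<lambda>i j. a i j - a i j0 / a i0 j0 * a i0 j"] by blast
    \<comment> \<open>The value at the pivot \<open>i0\<close> is what equation \<open>j0\<close>
      dictates. Substituting it turns each equation into its reduced form, and for \<open>j0\<close>
      itself all reduced coefficients vanish.\<close>
    define d where "d = c(i0 := - (\<Sum>i\<in>I'. c i * a i j0) / a i0 j0)"
    have sum_d: "(\<Sum>i\<in>I. d i * a i j) = (\<Sum>i\<in>I'. c i * (a i j - a i j0 / a i0 j0 * a i0 j))" for j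
    proof -
      have "(\<Sum>i\<in>I'. d i * a i j) = (\<Sum>i\<in>I'. c i * a i j)"
        using I'(2) by (intro sum.cong) (auto simp: d_def)
      then have "(\<Sum>i\<in>I. d i * a i j) =
          - (\<Sum>i\<in>I'. c i * a i j0) / a i0 j0 * a i0 j + (\<Sum>i\<in>I'. c i * a i j)"
        using I' by (simp add: d_def)
      also have "\<dots> = (\<Sum>i\<in>I'. c i * (a i j - a i j0 / a i0 j0 * a i0 j))"
        by (simp add: algebra_simps sum_subtractf sum_distrib_left sum_divide_distrib)
      finally show ?thesis .
    qed
    have "(\<Sum>i\<in>I. d i * a i j0) = 0"
      unfolding sum_d using i0 by simp
    moreover have "\<exists>i\<in>I. d i \<noteq> 0" using c(1) I' by (auto simp: d_def)
    ultimately show ?thesis using c(2) by (intro exI[of _ d]) (auto simp: sum_d)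
  qed
qed

text \<open>
  The operations of an \<^typ>\<open>('k, 'v) nspace\<close> satisfy no laws by themselves. Presenting the space as the
  image of a space of functions, whose operations are pointwise, provides these laws and gives
  access to finite sums. Both \<open>L_p\<close> and its quotients are of this form.
\<close>

locale function_surjection =
  fixes V :: "('a \<Rightarrow> 'k::real_normed_field) set" and X :: "('k, 'v) nspace"
    and \<pi> :: "('a \<Rightarrow> 'k) \<Rightarrow> 'v"
  assumes V_zero: "(\<lambda>x. 0) \<in> V"
    and V_add: "f \<in> V \<Longrightarrow> g \<in> V \<Longrightarrow> (\<lambda>x. f x + g x) \<in> V"
    and V_scale: "f \<in> V \<Longrightarrow> (\<lambda>x. c * f x) \<in> V"
    and image: "\<pi> ` V = carrier X"
    and map_zero: "zero X = \<pi> (\<lambda>x. 0)"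
    and map_add: "f \<in> V \<Longrightarrow> g \<in> V \<Longrightarrow> add X (\<pi> f) (\<pi> g) = \<pi> (\<lambda>x. f x + g x)"
    and map_scale: "f \<in> V \<Longrightarrow> scale X c (\<pi> f) = \<pi> (\<lambda>x. c * f x)"
begin

lemma V_diff: "f \<in> V \<Longrightarrow> g \<in> V \<Longrightarrow> (\<lambda>x. f x - g x) \<in> V"
  using V_add[OF _ V_scale[of g "-1"], of f] by simp

lemma V_sum: "finite I \<Longrightarrow> (\<And>i. i \<in> I \<Longrightarrow> f i \<in> V) \<Longrightarrow> (\<lambda>x. \<Sum>i\<in>I. c i * f i x) \<in> V"
  by (induction I rule: finite_induct) (auto intro!: V_zero V_add V_scale)

lemma carrierE:
  assumes "a \<in> carrier X" obtains f where "f \<in> V" "a = \<pi> f"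
  using assms image by blast

lemma map_in_carrier: "f \<in> V \<Longrightarrow> \<pi> f \<in> carrier X"
  using image by blast

lemma map_sum_in_subspace:
  assumes Y: "subspace_of Y X" and "finite I" "\<And>i. i \<in> I \<Longrightarrow> f i \<in> V \<and> \<pi> (f i) \<in> Y"
  shows "\<pi> (\<lambda>x. \<Sum>i\<in>I. c i * f i x) \<in> Y"
  using assms(2,3)
proof (induction I rule: finite_induct)
  case empty
  then show ?case using Y by (simp add: subspace_of_def map_zero)
next
  case (insert i I)
  have "\<pi> (\<lambda>x. c i * f i x) \<in> Y"
    using Y insert.prems[of i] map_scale[of "f i" "c i"] unfolding subspace_of_def by (metis insertI1)
  then have "add X (\<pi> (\<lambda>x. c i * f i x)) (\<pi> (\<lambda>x. \<Sum>i\<in>I. c i * f i x)) \<in> Y"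
    using Y insert by (auto simp: subspace_of_def)
  also have "add X (\<pi> (\<lambda>x. c i * f i x)) (\<pi> (\<lambda>x. \<Sum>i\<in>I. c i * f i x)) =
      \<pi> (\<lambda>x. c i * f i x + (\<Sum>i\<in>I. c i * f i x))"
    using insert by (intro map_add V_scale V_sum) auto
  finally show ?case using insert by simp
qed

lemma map_eq_iff:
  assumes "f \<in> V" "g \<in> V"
  shows "\<pi> f = \<pi> g \<longleftrightarrow> \<pi> (\<lambda>x. f x - g x) = zero X"
proof -
  have neg: "(\<lambda>x. - g x) \<in> V" using V_scale[OF assms(2), of "-1"] by simp
  have "\<pi> (\<lambda>x. f x - g x) = add X (\<pi> f) (\<pi> (\<lambda>x. - g x))"
    by (simp add: map_add assms neg)
  moreover have "add X (\<pi> g) (\<pi> (\<lambda>x. - g x)) = zero X"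
    by (simp add: map_add assms neg map_zero)
  moreover have "\<pi> f = add X (\<pi> (\<lambda>x. f x - g x)) (\<pi> g)"
    by (simp add: map_add assms V_diff)
  moreover have "add X (zero X) (\<pi> g) = \<pi> g"
    by (simp add: map_add assms V_zero map_zero)
  ultimately show ?thesis by metis
qed

text \<open>The linear combinations form a subspace containing the generators, the latter by
  Kronecker delta coefficients; conversely, every subspace containing the generators contains their
  combinations.\<close>

lemma lin_span_eq:
  fixes N :: nat
  assumes f: "\<And>j. j < N \<Longrightarrow> f j \<in> V"
  shows "lin_span X ((\<pi> \<circ> f) ` {..<N}) = range (\<lambda>c. \<pi> (\<lambda>x. \<Sum>j<N. c j * f j x))" (is "_ = ?R")
proof
  have sum: "(\<lambda>x. \<Sum>j<N. c j * f j x) \<in> V" for c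
    using f by (intro V_sum) auto
  have "subspace_of ?R X"
    unfolding subspace_of_def
  proof (intro conjI ballI allI)
    show "?R \<subseteq> carrier X" using sum by (auto intro: map_in_carrier)
    show "zero X \<in> ?R" by (auto simp: map_zero intro!: image_eqI[of _ _ "\<lambda>_. 0"])
  next
    fix a b assume "a \<in> ?R" "b \<in> ?R"
    then obtain c d where "a = \<pi> (\<lambda>x. \<Sum>j<N. c j * f j x)" "b = \<pi> (\<lambda>x. \<Sum>j<N. d j * f j x)" by blast
    then show "add X a b \<in> ?R"
      by (intro image_eqI[of _ _ "\<lambda>j. c j + d j"])
        (simp_all add: map_add[OF sum sum] algebra_simps sum.distrib)
  next
    fix e a assume "a \<in> ?R"
    then obtain c where "a = \<pi> (\<lambda>x. \<Sum>j<N. c j * f j x)" by blast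
    then show "scale X e a \<in> ?R"
      by (intro image_eqI[of _ _ "\<lambda>j. e * c j"])
        (simp_all add: map_scale[OF sum] sum_distrib_left mult.assoc)
  qed
  moreover have "(\<pi> \<circ> f) ` {..<N} \<subseteq> ?R"
  proof (rule image_subsetI)
    fix i assume i: "i \<in> {..<N}"
    have "(\<lambda>x. \<Sum>j<N. (if j = i then 1 else 0) * f j x) = f i"
      using i by (simp add: if_distrib[of "\<lambda>c. c * _"] cong: if_cong)
    then show "(\<pi> \<circ> f) i \<in> ?R" by (intro image_eqI[of _ _ "\<lambda>j. if j = i then 1 else 0"]) auto
  qed
  ultimately show "lin_span X ((\<pi> \<circ> f) ` {..<N}) \<subseteq> ?R"
    unfolding lin_span_def by blast
next
  show "?R \<subseteq> lin_span X ((\<pi> \<circ> f) ` {..<N})"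
    unfolding lin_span_def using f by (auto intro!: map_sum_in_subspace[OF _ finite_lessThan])
qed

text \<open>Lifting the generators along \<open>\<pi>\<close> moves finite dimension to the level of
  functions, where linear combinations are ordinary finite sums.\<close>

lemma finite_dim_iff:
  "finite_dim X \<longleftrightarrow>
    (\<exists>N f. (\<forall>j<N. f j \<in> V) \<and> (\<forall>h\<in>V. \<exists>c. \<pi> h = \<pi> (\<lambda>x. \<Sum>j<N::nat. c j * f j x)))"
proof
  assume "finite_dim X"
  then obtain F where F: "finite F" "F \<subseteq> carrier X" "lin_span X F = carrier X"
    by (auto simp: finite_dim_def)
  obtain N :: nat and e where e: "F = e ` {..<N}"
    using finite_imp_nat_seg_image_inj_on[OF F(1)] by (auto simp: lessThan_def)
  have "\<forall>j<N. \<exists>f\<in>V. e j = \<pi> f" using F(2) e image by blast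
  then obtain f where f: "\<And>j. j < N \<Longrightarrow> f j \<in> V \<and> e j = \<pi> (f j)" by metis
  have "F = (\<pi> \<circ> f) ` {..<N}" using f by (auto simp: e)
  then have "range (\<lambda>c. \<pi> (\<lambda>x. \<Sum>j<N. c j * f j x)) = carrier X"
    using lin_span_eq[of N f] f F(3) by simp
  then have "\<forall>h\<in>V. \<exists>c. \<pi> h = \<pi> (\<lambda>x. \<Sum>j<N. c j * f j x)"
    using map_in_carrier by blast
  then show "\<exists>N f. (\<forall>j<N. f j \<in> V) \<and> (\<forall>h\<in>V. \<exists>c. \<pi> h = \<pi> (\<lambda>x. \<Sum>j<N::nat. c j * f j x))"
    using f by blast
next
  assume "\<exists>N f. (\<forall>j<N. f j \<in> V) \<and> (\<forall>h\<in>V. \<exists>c. \<pi> h = \<pi> (\<lambda>x. \<Sum>j<N::nat. c j * f j x))"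
  then obtain N :: nat and f where f: "\<And>j. j < N \<Longrightarrow> f j \<in> V"
    and span: "\<And>h. h \<in> V \<Longrightarrow> \<exists>c. \<pi> h = \<pi> (\<lambda>x. \<Sum>j<N. c j * f j x)" by blast
  have "lin_span X ((\<pi> \<circ> f) ` {..<N}) = carrier X"
  proof (subst lin_span_eq)
    show "range (\<lambda>c. \<pi> (\<lambda>x. \<Sum>j<N. c j * f j x)) = carrier X"
      unfolding image[symmetric] using span f by (auto intro!: imageI V_sum simp: image_iff)
  qed (use f in auto)
  then show "finite_dim X"
    unfolding finite_dim_def using f map_in_carrier
    by (intro exI[of _ "(\<pi> \<circ> f) ` {..<N}"]) auto
qed

text \<open>With \<open>N\<close> generators, the coordinates of the \<open>N + 1\<close> vectors
  \<open>g 0, ..., g N\<close> form a system with more unknowns than equations. Applied to a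
  quotient by \<open>Y\<close>, the dependence yields a combination lying in
  \<open>Y\<close>.\<close>

lemma finite_dim_dependent:
  assumes "finite_dim X" and g: "\<And>i. g i \<in> V"
  obtains N :: nat and c where "\<exists>i\<le>N. c i \<noteq> 0" "\<pi> (\<lambda>x. \<Sum>i\<le>N. c i * g i x) = zero X"
proof -
  obtain N :: nat and f where f: "\<And>j. j < N \<Longrightarrow> f j \<in> V"
    and span: "\<And>h. h \<in> V \<Longrightarrow> \<exists>c. \<pi> h = \<pi> (\<lambda>x. \<Sum>j<N. c j * f j x)"
    using assms(1) unfolding finite_dim_iff by blast
  have "\<forall>i. \<exists>c. \<pi> (g i) = \<pi> (\<lambda>x. \<Sum>j<N. c j * f j x)" using g span by blast
  then obtain a where a: "\<And>i. \<pi> (g i) = \<pi> (\<lambda>x. \<Sum>j<N. a i j * f j x)" by metis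
  obtain c where c: "\<exists>i\<in>{..N}. c i \<noteq> 0" "\<forall>j\<in>{..<N}. (\<Sum>i\<le>N. c i * a i j) = 0"
    using underdetermined_homogeneous_system[of "{..<N}" "{..N}" a] by auto
  have sum: "(\<lambda>x. \<Sum>j<N. a i j * f j x) \<in> V" for i
    using f by (intro V_sum) auto
  \<comment> \<open>Each \<open>?d i\<close> maps to zero, being \<open>g i\<close> minus its
    expansion in the generators. Weighted with \<open>c\<close>, the expansions cancel, so the sum
    of the \<open>c i * g i\<close> maps to zero as well.\<close>
  let ?d = "\<lambda>i x. g i x - (\<Sum>j<N. a i j * f j x)"
  have d: "?d i \<in> V" "\<pi> (?d i) = zero X" for i
    using V_diff[OF g sum] a map_eq_iff[OF g sum] by auto
  have "subspace_of {zero X} X"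
    using map_in_carrier[OF V_zero] map_add[OF V_zero V_zero] map_scale[OF V_zero]
    by (auto simp: subspace_of_def map_zero)
  then have "\<pi> (\<lambda>x. \<Sum>i\<le>N. c i * ?d i x) \<in> {zero X}"
    using d by (intro map_sum_in_subspace) auto
  moreover have "(\<Sum>i\<le>N. c i * ?d i x) = (\<Sum>i\<le>N. c i * g i x)" for x
  proof -
    have "(\<Sum>i\<le>N. c i * (\<Sum>j<N. a i j * f j x)) = (\<Sum>i\<le>N. \<Sum>j<N. c i * a i j * f j x)"
      by (simp add: sum_distrib_left mult.assoc)
    also have "\<dots> = (\<Sum>j<N. (\<Sum>i\<le>N. c i * a i j) * f j x)"
      by (subst sum.swap) (simp add: sum_distrib_right)
    also have "\<dots> = 0" using c(2) by (intro sum.neutral) auto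
    finally show ?thesis by (simp add: right_diff_distrib sum_subtractf)
  qed
  ultimately show ?thesis using that[of N c] c(1) by auto
qed

section \<open>Quotients by a subspace\<close>

context
  fixes Y assumes Y: "subspace_of Y X"
begin

lemma subspaceE:
  assumes "y \<in> Y" obtains f where "f \<in> V" "y = \<pi> f"
  using assms Y carrierE unfolding subspace_of_def by blast

lemma coset_map:
  assumes f: "f \<in> V"
  shows "coset X Y (\<pi> f) = {\<pi> g | g. g \<in> V \<and> \<pi> (\<lambda>x. g x - f x) \<in> Y}"
proof (intro set_eqI iffI)
  fix a assume "a \<in> coset X Y (\<pi> f)"
  then obtain y where y: "y \<in> Y" "a = add X (\<pi> f) y" by (auto simp: coset_def)
  then obtain h where h: "h \<in> V" "y = \<pi> h"
    using y(1) by (elim subspaceE)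
  show "a \<in> {\<pi> g | g. g \<in> V \<and> \<pi> (\<lambda>x. g x - f x) \<in> Y}"
    using y h f V_add map_add by (intro CollectI exI[of _ "\<lambda>x. f x + h x"]) auto
next
  fix a assume "a \<in> {\<pi> g | g. g \<in> V \<and> \<pi> (\<lambda>x. g x - f x) \<in> Y}"
  then obtain g where g: "g \<in> V" "\<pi> (\<lambda>x. g x - f x) \<in> Y" "a = \<pi> g" by blast
  then show "a \<in> coset X Y (\<pi> f)"
    unfolding coset_def using map_add[OF f V_diff[OF g(1) f]]
    by (intro image_eqI[of _ _ "\<pi> (\<lambda>x. g x - f x)"]) auto
qed

lemma map_add_in: "f \<in> V \<Longrightarrow> g \<in> V \<Longrightarrow> \<pi> f \<in> Y \<Longrightarrow> \<pi> g \<in> Y \<Longrightarrow> \<pi> (\<lambda>x. f x + g x) \<in> Y"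
  using Y map_add unfolding subspace_of_def by metis

lemma map_scale_in: "f \<in> V \<Longrightarrow> \<pi> f \<in> Y \<Longrightarrow> \<pi> (\<lambda>x. c * f x) \<in> Y"
  using Y map_scale unfolding subspace_of_def by metis

lemma coset_zero: "coset X Y (\<pi> (\<lambda>x. 0)) = Y"
  unfolding coset_map[OF V_zero] by (auto elim: subspaceE)

text \<open>Coset arithmetic makes a quotient again an image of the same function space
  \<open>V\<close>. This is used twice: \<open>L_p\<close> is the quotient of the
  \<open>p\<close>-integrable functions by the null functions, and finite codimension concerns a
  further quotient of \<open>L_p\<close>.\<close>

lemma quotient: "function_surjection V (quotient_space X Y) (coset X Y \<circ> \<pi>)"
proof
  show "(coset X Y \<circ> \<pi>) ` V = carrier (quotient_space X Y)"
    by (auto simp: quotient_space_def image[symmetric])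
  show "zero (quotient_space X Y) = (coset X Y \<circ> \<pi>) (\<lambda>x. 0)"
    by (simp add: quotient_space_def coset_zero)
next
  fix f g assume f: "f \<in> V" and g: "g \<in> V"
  have "{add X a b |a b. a \<in> coset X Y (\<pi> f) \<and> b \<in> coset X Y (\<pi> g)} = coset X Y (\<pi> (\<lambda>x. f x + g x))"
    (is "?L = ?R")
  proof (intro set_eqI iffI)
    fix a assume "a \<in> ?L"
    then obtain u v where u: "u \<in> V" "\<pi> (\<lambda>x. u x - f x) \<in> Y" and v: "v \<in> V" "\<pi> (\<lambda>x. v x - g x) \<in> Y"
      and a: "a = \<pi> (\<lambda>x. u x + v x)"
      by (auto simp: coset_map f g map_add)
    have "\<pi> (\<lambda>x. (u x + v x) - (f x + g x)) \<in> Y"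
      using map_add_in[OF V_diff[OF u(1) f] V_diff[OF v(1) g] u(2) v(2)]
      by (simp add: algebra_simps)
    then show "a \<in> ?R" using a u v by (auto simp: coset_map V_add f g)
  next
    fix a assume "a \<in> ?R"
    then obtain w where w: "w \<in> V" "\<pi> (\<lambda>x. w x - (f x + g x)) \<in> Y" and a: "a = \<pi> w"
      by (auto simp: coset_map V_add f g)
    have "\<pi> f \<in> coset X Y (\<pi> f)"
      using f Y map_zero by (auto simp: coset_map subspace_of_def)
    moreover have "\<pi> (\<lambda>x. w x - f x) \<in> coset X Y (\<pi> g)"
      using w V_diff[OF w(1) f] g by (auto simp: coset_map algebra_simps)
    moreover have "a = add X (\<pi> f) (\<pi> (\<lambda>x. w x - f x))"
      using f V_diff[OF w(1) f] a by (simp add: map_add)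
    ultimately show "a \<in> ?L" by blast
  qed
  then show "add (quotient_space X Y) ((coset X Y \<circ> \<pi>) f) ((coset X Y \<circ> \<pi>) g) =
      (coset X Y \<circ> \<pi>) (\<lambda>x. f x + g x)"
    by (simp add: quotient_space_def)
next
  fix f c assume f: "f \<in> V"
  have "{add X (scale X c a) y |a y. a \<in> coset X Y (\<pi> f) \<and> y \<in> Y} = coset X Y (\<pi> (\<lambda>x. c * f x))"
    (is "?L = ?R")
  proof (intro set_eqI iffI)
    fix a assume "a \<in> ?L"
    then obtain u y where u: "u \<in> V" "\<pi> (\<lambda>x. u x - f x) \<in> Y" and y: "y \<in> Y"
      and a: "a = add X (\<pi> (\<lambda>x. c * u x)) y"
      by (auto simp: coset_map f map_scale)
    obtain v where v: "v \<in> V" "y = \<pi> v"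
      using y by (elim subspaceE)
    have "\<pi> (\<lambda>x. c * (u x - f x) + v x) \<in> Y"
      using map_add_in[OF V_scale[OF V_diff[OF u(1) f]] v(1) map_scale_in[OF V_diff[OF u(1) f] u(2)]] v y
      by simp
    then have "\<pi> (\<lambda>x. c * u x + v x - c * f x) \<in> Y" by (simp add: algebra_simps)
    then show "a \<in> ?R" using a u v by (auto simp: coset_map V_add V_scale f map_add)
  next
    fix a assume "a \<in> ?R"
    then obtain w where w: "w \<in> V" "\<pi> (\<lambda>x. w x - c * f x) \<in> Y" and a: "a = \<pi> w"
      by (auto simp: coset_map V_scale f)
    have "\<pi> f \<in> coset X Y (\<pi> f)"
      using f Y map_zero by (auto simp: coset_map subspace_of_def)
    \<comment> \<open>The additional summand from \<open>Y\<close> absorbs \<open>w - c f\<close>;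
      this works uniformly in \<open>c\<close>, including \<open>c = 0\<close>.\<close>
    moreover have "a = add X (scale X c (\<pi> f)) (\<pi> (\<lambda>x. w x - c * f x))"
      using f V_diff[OF w(1) V_scale[OF f, of c]] a by (simp add: map_add map_scale V_scale)
    ultimately show "a \<in> ?L" using w(2) by blast
  qed
  then show "scale (quotient_space X Y) c ((coset X Y \<circ> \<pi>) f) = (coset X Y \<circ> \<pi>) (\<lambda>x. c * f x)"
    by (simp add: quotient_space_def)
qed (auto intro: V_zero V_add V_scale)

text \<open>The kernel of the quotient map is \<open>Y\<close>; this turns a linear dependence in
  the quotient into membership in \<open>Y\<close>.\<close>

lemma coset_map_eq_self_iff:
  assumes "f \<in> V"
  shows "coset X Y (\<pi> f) = Y \<longleftrightarrow> \<pi> f \<in> Y"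
proof
  show "\<pi> f \<in> Y" if "coset X Y (\<pi> f) = Y"
  proof -
    have "\<pi> f \<in> coset X Y (\<pi> f)"
      using assms Y map_zero by (auto simp: coset_map subspace_of_def)
    then show ?thesis using that by simp
  qed
next
  assume f: "\<pi> f \<in> Y"
  have "\<pi> (\<lambda>x. g x - f x) \<in> Y \<longleftrightarrow> \<pi> g \<in> Y" if g: "g \<in> V" for g
    using map_add_in[OF V_diff[OF g assms] assms _ f]
      map_add_in[OF g V_scale[OF assms, of "-1"] _ map_scale_in[OF assms f, of "-1"]] by auto
  then have "coset X Y (\<pi> f) = {\<pi> g | g. g \<in> V \<and> \<pi> g \<in> Y}"
    unfolding coset_map[OF assms] by (intro Collect_cong) blast
  also have "\<dots> = Y" by (auto elim: subspaceE)
  finally show "coset X Y (\<pi> f) = Y" .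
qed

end

end

text \<open>For positive arguments this is convexity of the power function. If one argument is zero,
  only \<open>s powr p \<le> s\<close> for \<open>s\<close> between 0 and 1 is left.\<close>

lemma powr_convex_combination:
  fixes a b p t :: real
  assumes p: "1 \<le> p" and ab: "0 \<le> a" "0 \<le> b" and t: "0 \<le> t" "t \<le> 1"
  shows "((1 - t) * a + t * b) powr p \<le> (1 - t) * a powr p + t * b powr p"
proof -
  have scaled: "(s * c) powr p \<le> s * c powr p" if "0 \<le> s" "s \<le> 1" "0 \<le> c" for s c :: real
  proof -
    have "s powr p \<le> s powr 1" using that p by (intro powr_mono') auto
    then have "s powr p \<le> s" using that by simp
    then show ?thesis using that by (simp add: powr_mult mult_right_mono)
  qed
  consider "a = 0" | "b = 0" | "a > 0" "b > 0" using ab by linarith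
  then show ?thesis
  proof cases
    case 3
    then show ?thesis using convex_onD[OF powr_convex[OF p], of t a b] t by simp
  qed (use scaled[of t b] scaled[of "1 - t" a] p ab t in auto)
qed

subsection \<open>The norm of \<open>L_p\<close> over a measurable set\<close>

lemma Lp_functions_simps [simp]:
  "zero (Lp_functions M p) = (\<lambda>x. 0)"
  "add (Lp_functions M p) f g = (\<lambda>x. f x + g x)"
  "scale (Lp_functions M p) c f = (\<lambda>x. c * f x)"
  by (auto simp: Lp_functions_def)

text \<open>The \<open>p\<close>-norm of \<open>f\<close> cut off outside \<open>E\<close>. The
  indicator stands outside the power, so that the integrals over disjoint sets simply add
  up.\<close>

definition Lp_seminorm :: "'a measure \<Rightarrow> real \<Rightarrow> 'a set \<Rightarrow> ('a \<Rightarrow> 'k::real_normed_field) \<Rightarrow> real" where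
  "Lp_seminorm M p E f = (\<integral>x. indicator E x * norm (f x) powr p \<partial>M) powr (1 / p)"

locale Lp_exponent =
  fixes M :: "'a measure" and p :: real
    and V :: "('a \<Rightarrow> 'k::{real_normed_field, second_countable_topology}) set"
  assumes p: "1 \<le> p"
  defines "V \<equiv> carrier (Lp_functions M p)"
begin

lemma V_iff: "f \<in> V \<longleftrightarrow> f \<in> borel_measurable M \<and> integrable M (\<lambda>x. norm (f x) powr p)"
  by (simp add: V_def Lp_functions_def)

lemma V_dominated:
  assumes "g \<in> V" "f \<in> borel_measurable M" "\<And>x. norm (f x) \<le> norm (g x)"
  shows "f \<in> V"
  unfolding V_iff
proof
  have "integrable M (\<lambda>x. norm (g x) powr p)" using assms(1) by (simp add: V_iff)
  then show "integrable M (\<lambda>x. norm (f x) powr p)"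
    using assms(2,3) p
    by (elim Bochner_Integration.integrable_bound) (auto intro!: AE_I2 powr_mono2)
qed (rule assms(2))

lemma function_space: "function_surjection V (Lp_functions M p) (\<lambda>f. f)"
proof
  show "(\<lambda>x. 0) \<in> V" using p by (simp add: V_iff)
next
  fix f :: "'a \<Rightarrow> 'k" and c assume "f \<in> V"
  then show "(\<lambda>x. c * f x) \<in> V"
    by (auto simp: V_iff norm_mult powr_mult)
next
  fix f g :: "'a \<Rightarrow> 'k" assume f: "f \<in> V" and g: "g \<in> V"
  \<comment> \<open>The sum is twice a midpoint: the factor 2 gives \<open>2 powr p\<close>, and
    convexity bounds the power of the midpoint.\<close>
  have bound: "norm (f x + g x) powr p \<le> 2 powr p * (norm (f x) powr p + norm (g x) powr p)" for x
  proof -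
    have "norm (f x + g x) powr p \<le> (norm (f x) + norm (g x)) powr p"
      using p by (intro powr_mono2 norm_triangle_ineq) auto
    also have "\<dots> = 2 powr p * ((1 - 1/2) * norm (f x) + 1/2 * norm (g x)) powr p"
      by (simp flip: powr_mult add: distrib_left)
    also have "\<dots> \<le> 2 powr p * ((1 - 1/2) * norm (f x) powr p + 1/2 * norm (g x) powr p)"
      by (intro mult_left_mono powr_convex_combination p) auto
    also have "\<dots> \<le> 2 powr p * (norm (f x) powr p + norm (g x) powr p)"
      by (intro mult_left_mono add_mono) auto
    finally show ?thesis .
  qed
  have int: "integrable M (\<lambda>x. 2 powr p * (norm (f x) powr p + norm (g x) powr p))"
    using f g by (simp add: V_iff)
  have meas: "(\<lambda>x. f x + g x) \<in> borel_measurable M"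
    using f g by (auto simp: V_iff intro: borel_measurable_add)
  have "integrable M (\<lambda>x. norm (f x + g x) powr p)"
    using meas by (intro Bochner_Integration.integrable_bound[OF int]) (auto simp: bound)
  then show "(\<lambda>x. f x + g x) \<in> V" using meas by (simp add: V_iff)
qed (auto simp: V_def)

sublocale Fun: function_surjection V "Lp_functions M p" "\<lambda>f. f"
  by (rule function_space)

definition cls :: "('a \<Rightarrow> 'k) \<Rightarrow> ('a \<Rightarrow> 'k) set" where
  "cls f = coset (Lp_functions M p) (Lp_null M) f"

lemma null_subspace: "subspace_of (Lp_null M :: ('a \<Rightarrow> 'k) set) (Lp_functions M p)"
  unfolding subspace_of_def
proof (intro conjI ballI allI)
  show "Lp_null M \<subseteq> carrier (Lp_functions M p :: ('k, _) nspace)"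
  proof
    fix f :: "'a \<Rightarrow> 'k" assume f: "f \<in> Lp_null M"
    then have meas: "f \<in> borel_measurable M" by (simp add: Lp_null_def)
    have ae: "AE x in M. 0 = norm (f x) powr p" using f by (auto simp: Lp_null_def)
    have "(\<lambda>x. norm (f x) powr p) \<in> borel_measurable M" using meas by measurable
    then have "integrable M (\<lambda>x. norm (f x) powr p)"
      by (rule integrable_cong_AE_imp[OF integrable_zero _ ae])
    then show "f \<in> carrier (Lp_functions M p)" using meas by (simp add: Lp_functions_def)
  qed
qed (auto simp: Lp_null_def)

sublocale Lp: function_surjection V "Lp TYPE('k) M p" cls
  using Fun.quotient[OF null_subspace] by (simp add: Lp_def comp_def cls_def[abs_def])

lemma cls_eq_iff: "f \<in> V \<Longrightarrow> g \<in> V \<Longrightarrow> cls f = cls g \<longleftrightarrow> (AE x in M. f x = g x)"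
  using coset_Lp_null[of f M p] coset_Lp_null[of g M p] unfolding cls_def V_def[symmetric]
  by (auto elim: eventually_elim2)

lemma integrable_restrict:
  assumes "f \<in> V" "E \<in> sets M"
  shows "integrable M (\<lambda>x. indicator E x * norm (f x) powr p)"
  using integrable_mult_indicator[OF assms(2), of "\<lambda>x. norm (f x) powr p"] assms(1)
  by (simp add: V_iff)

abbreviation "S \<equiv> Lp_seminorm M p :: _ \<Rightarrow> ('a \<Rightarrow> 'k) \<Rightarrow> _"

lemma integral_restrict_nonneg: "0 \<le> (\<integral>x. indicator E x * norm (f x :: 'k) powr p \<partial>M)"
  by (intro integral_nonneg_AE) auto

lemma S_nonneg: "0 \<le> S E f"
  by (simp add: Lp_seminorm_def)

lemma S_powr: "S E f powr p = (\<integral>x. indicator E x * norm (f x) powr p \<partial>M)"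
  using p integral_restrict_nonneg[of E f] by (simp add: Lp_seminorm_def powr_powr)

lemma S_le_iff:
  assumes "0 \<le> r"
  shows "S E f \<le> r \<longleftrightarrow> (\<integral>x. indicator E x * norm (f x) powr p \<partial>M) \<le> r powr p"
proof
  assume "S E f \<le> r"
  then show "(\<integral>x. indicator E x * norm (f x) powr p \<partial>M) \<le> r powr p"
    unfolding S_powr[symmetric] using p by (intro powr_mono2 S_nonneg) auto
next
  assume "(\<integral>x. indicator E x * norm (f x) powr p \<partial>M) \<le> r powr p"
  then have "S E f \<le> (r powr p) powr (1 / p)"
    unfolding Lp_seminorm_def using p by (intro powr_mono2 integral_restrict_nonneg) auto
  then show "S E f \<le> r" using assms p by (simp add: powr_powr)
qed

lemma S_scale: "S E (\<lambda>x. c * f x) = norm c * S E f"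
proof -
  have "S E (\<lambda>x. c * f x) = (norm c powr p * (\<integral>x. indicator E x * norm (f x) powr p \<partial>M)) powr (1 / p)"
    by (simp add: Lp_seminorm_def norm_mult powr_mult mult.left_commute flip: integral_mult_right_zero)
  also have "\<dots> = norm c * S E f"
    using p integral_restrict_nonneg[of E f] by (simp add: powr_mult powr_powr Lp_seminorm_def)
  finally show ?thesis .
qed

lemma S_cong:
  assumes "f \<in> V" "g \<in> V" "E \<in> sets M" "AE x in M. f x = g x"
  shows "S E f = S E g"
  unfolding Lp_seminorm_def
  using assms(4) integrable_restrict[OF assms(1,3)] integrable_restrict[OF assms(2,3)]
  by (intro arg_cong[where f = "\<lambda>c. c powr _"] integral_cong_AE) auto

lemma S_mono:
  assumes "f \<in> V" "E \<in> sets M"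
  shows "S E f \<le> S (space M) f"
  unfolding Lp_seminorm_def using assms p
  by (intro powr_mono2 integral_mono integrable_restrict integral_restrict_nonneg)
    (auto simp: indicator_def)

lemma S_eq_0_iff:
  assumes "f \<in> V" "E \<in> sets M"
  shows "S E f = 0 \<longleftrightarrow> (AE x in M. x \<in> E \<longrightarrow> f x = 0)"
proof -
  have "S E f = 0 \<longleftrightarrow> (\<integral>x. indicator E x * norm (f x) powr p \<partial>M) = 0"
    by (simp add: Lp_seminorm_def)
  also have "\<dots> \<longleftrightarrow> (AE x in M. indicator E x * norm (f x) powr p = 0)"
    using assms by (intro integral_nonneg_eq_0_iff_AE integrable_restrict) auto
  also have "\<dots> \<longleftrightarrow> (AE x in M. x \<in> E \<longrightarrow> f x = 0)"
    by (intro AE_cong) (auto simp: indicator_def)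
  finally show ?thesis .
qed

text \<open>Pointwise convexity of the power function is integrated over \<open>E\<close>; no
  Hoelder inequality is involved.\<close>

lemma S_le_1_convex_combination:
  assumes fg: "f \<in> V" "g \<in> V" and E: "E \<in> sets M" and le: "S E f \<le> 1" "S E g \<le> 1"
    and t: "0 \<le> t" "t \<le> 1"
  shows "S E (\<lambda>x. of_real (1 - t) * f x + of_real t * g x) \<le> 1"
proof -
  let ?h = "\<lambda>x. of_real (1 - t) * f x + of_real t * g x"
  have h: "?h \<in> V" using fg by (intro Fun.V_add Fun.V_scale)
  have pointwise: "norm (?h x) powr p \<le> (1 - t) * norm (f x) powr p + t * norm (g x) powr p" for x
  proof -
    have "norm (?h x) \<le> (1 - t) * norm (f x) + t * norm (g x)"
      using t norm_triangle_ineq[of "of_real (1 - t) * f x" "of_real t * g x"]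
      unfolding norm_mult norm_of_real by simp
    then have "norm (?h x) powr p \<le> ((1 - t) * norm (f x) + t * norm (g x)) powr p"
      using p by (intro powr_mono2) auto
    also have "\<dots> \<le> (1 - t) * norm (f x) powr p + t * norm (g x) powr p"
      using t by (intro powr_convex_combination p) auto
    finally show ?thesis .
  qed
  note int = integrable_restrict[OF _ E]
  have "(\<integral>x. indicator E x * norm (?h x) powr p \<partial>M) \<le>
      (\<integral>x. (1 - t) * (indicator E x * norm (f x) powr p) + t * (indicator E x * norm (g x) powr p) \<partial>M)"
    using int[OF fg(1)] int[OF fg(2)] pointwise
    by (intro integral_mono int[OF h]) (auto simp: indicator_def)
  also have "\<dots> = (1 - t) * S E f powr p + t * S E g powr p"
    using int[OF fg(1)] int[OF fg(2)] by (simp add: S_powr)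
  also have "\<dots> \<le> (1 - t) * 1 + t * 1"
    using t le p S_nonneg[of E f] S_nonneg[of E g]
      powr_mono2[of p "S E f" 1] powr_mono2[of p "S E g" 1]
    by (intro add_mono mult_left_mono) auto
  finally show ?thesis by (simp add: S_le_iff)
qed

text \<open>Minkowski's inequality follows from convexity of the unit ball by normalizing \<open>f\<close> and \<open>g\<close>.\<close>

lemma S_triangle:
  assumes fg: "f \<in> V" "g \<in> V" and E: "E \<in> sets M"
  shows "S E (\<lambda>x. f x + g x) \<le> S E f + S E g"
proof (rule field_le_epsilon)
  fix e :: real assume e: "e > 0"
  \<comment> \<open>The summands \<open>e / 2\<close> keep both normalizing constants positive even
    when a seminorm vanishes.\<close>
  define a b where "a = S E f + e / 2" and "b = S E g + e / 2"
  have ab: "a > 0" "b > 0" "S E f \<le> a" "S E g \<le> b"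
    using e S_nonneg[of E f] S_nonneg[of E g] by (auto simp: a_def b_def)
  \<comment> \<open>With this weight \<open>(1 - t) / a\<close> and \<open>t / b\<close> both equal
    \<open>1 / (a + b)\<close>, so the combination of the normalized functions is a multiple of
    \<open>f + g\<close>.\<close>
  define t where "t = b / (a + b)"
  have t: "0 \<le> t" "t \<le> 1" "1 - t = a / (a + b)" using ab by (auto simp: t_def field_simps)
  let ?f = "\<lambda>x. of_real (1 / a) * f x" and ?g = "\<lambda>x. of_real (1 / b) * g x"
  have V: "?f \<in> V" "?g \<in> V" using Fun.V_scale fg by blast+
  have "S E ?f \<le> 1" "S E ?g \<le> 1"
    unfolding S_scale norm_of_real using ab by (auto simp: field_simps)
  then have "S E (\<lambda>x. of_real (1 - t) * ?f x + of_real t * ?g x) \<le> 1"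
    using V E t by (intro S_le_1_convex_combination) auto
  also have "(\<lambda>x. of_real (1 - t) * ?f x + of_real t * ?g x) = (\<lambda>x. of_real (1 / (a + b)) * (f x + g x))"
  proof
    fix x
    have "of_real (1 - t) * ?f x = of_real (1 / (a + b)) * f x"
      using ab unfolding t(3) mult.assoc[symmetric] of_real_mult[symmetric] by simp
    moreover have "of_real t * ?g x = of_real (1 / (a + b)) * g x"
      using ab unfolding t_def mult.assoc[symmetric] of_real_mult[symmetric] by simp
    ultimately show "of_real (1 - t) * ?f x + of_real t * ?g x = of_real (1 / (a + b)) * (f x + g x)"
      by (simp only: distrib_left)
  qed
  finally have "S E (\<lambda>x. f x + g x) \<le> a + b"
    unfolding S_scale norm_of_real using ab by (simp add: field_simps)
  then show "S E (\<lambda>x. f x + g x) \<le> S E f + S E g + e" by (simp add: a_def b_def)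
qed

lemma S_diff:
  assumes "f \<in> V" "g \<in> V" "E \<in> sets M"
  shows "S E (\<lambda>x. f x - g x) \<le> S E f + S E g"
  using S_triangle[OF assms(1) Fun.V_scale[OF assms(2), of "-1"] assms(3)]
    S_scale[of E "-1" g] by simp

section \<open>Norm and metric on classes of functions\<close>

lemma vnorm_cls: "f \<in> V \<Longrightarrow> vnorm (Lp TYPE('k) M p) (cls f) = S (space M) f"
  using vnorm_Lp[of f M p] unfolding V_def cls_def Lp_seminorm_def
  by (simp cong: Bochner_Integration.integral_cong)

lemma cls_diff:
  assumes "f \<in> V" "g \<in> V"
  shows "add (Lp TYPE('k) M p) (cls f) (scale (Lp TYPE('k) M p) (-1) (cls g)) = cls (\<lambda>x. f x - g x)"
  using assms Fun.V_scale[OF assms(2), of "-1"] by (simp add: Lp.map_add Lp.map_scale)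

lemma ndist_cls:
  assumes "f \<in> V" "g \<in> V"
  shows "ndist (Lp TYPE('k) M p) (cls f) (cls g) = S (space M) (\<lambda>x. f x - g x)"
  unfolding ndist_def using assms
  by (simp add: Lp.map_in_carrier cls_diff vnorm_cls Fun.V_diff)

lemma metric: "Metric_space (carrier (Lp TYPE('k) M p)) (ndist (Lp TYPE('k) M p))"
proof
  let ?X = "Lp TYPE('k) M p"
  have vnorm: "0 \<le> vnorm ?X a" if "a \<in> carrier ?X" for a
    using that by (auto elim!: Lp.carrierE simp: vnorm_cls S_nonneg)
  show "0 \<le> ndist ?X a b" for a b
  proof (cases "a \<in> carrier ?X \<and> b \<in> carrier ?X")
    case True
    then show ?thesis by (auto elim!: Lp.carrierE simp: ndist_cls S_nonneg)
  qed (auto simp: ndist_def)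
  show "ndist ?X a b = ndist ?X b a" for a b
  proof (cases "a \<in> carrier ?X \<and> b \<in> carrier ?X")
    case True
    then obtain f g where f: "f \<in> V" "a = cls f" and g: "g \<in> V" "b = cls g"
      by (auto elim!: Lp.carrierE)
    then show ?thesis
      using S_scale[of "space M" "-1" "\<lambda>x. f x - g x"] by (simp add: ndist_cls)
  qed (auto simp: ndist_def)
  fix a b c assume "a \<in> carrier ?X" "b \<in> carrier ?X"
  then obtain f g where f: "f \<in> V" "a = cls f" and g: "g \<in> V" "b = cls g"
    by (auto elim!: Lp.carrierE)
  show "ndist ?X a b = 0 \<longleftrightarrow> a = b"
    using f g by (simp add: ndist_cls S_eq_0_iff Fun.V_diff cls_eq_iff)
  assume "c \<in> carrier ?X"
  then obtain h where h: "h \<in> V" "c = cls h" by (auto elim!: Lp.carrierE)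
  show "ndist ?X a c \<le> ndist ?X a b + ndist ?X b c"
    using S_triangle[of "\<lambda>x. f x - g x" "\<lambda>x. g x - h x" "space M"] f g h
    by (simp add: ndist_cls Fun.V_diff)
qed

section \<open>Sublevel sets of the seminorms, the building blocks of the covering\<close>

definition sublevel :: "'a set \<Rightarrow> real \<Rightarrow> ('a \<Rightarrow> 'k) set set" where
  "sublevel E r = cls ` {f \<in> V. S E f \<le> r}"

lemma cls_in_sublevel_iff:
  assumes "f \<in> V" "E \<in> sets M"
  shows "cls f \<in> sublevel E r \<longleftrightarrow> S E f \<le> r"
proof
  assume "cls f \<in> sublevel E r"
  then obtain g where "g \<in> V" "S E g \<le> r" "cls f = cls g" by (auto simp: sublevel_def)
  then show "S E f \<le> r" using S_cong[of f g E] assms cls_eq_iff by auto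
qed (use assms in \<open>auto simp: sublevel_def\<close>)

lemma sublevel_subset: "sublevel E r \<subseteq> carrier (Lp TYPE('k) M p)"
  by (auto simp: sublevel_def intro: Lp.map_in_carrier)

lemma unit_ball_eq: "unit_ball (Lp TYPE('k) M p) = sublevel (space M) 1"
  by (auto simp: unit_ball_def vnorm_cls sublevel_def Lp.map_in_carrier elim!: Lp.carrierE)

text \<open>By \<open>S_triangle\<close> and \<open>S_mono\<close> the seminorm over
  \<open>E\<close> is 1-Lipschitz for the metric. Around a class outside the set, the open ball
  whose radius is the excess over \<open>r\<close> therefore stays outside.\<close>

lemma closed_sublevel:
  assumes E: "E \<in> sets M"
  shows "closed_subset (Lp TYPE('k) M p) (sublevel E r)"
proof -
  interpret Metric_space "carrier (Lp TYPE('k) M p)" "ndist (Lp TYPE('k) M p)" by (rule metric)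
  show ?thesis
    unfolding closed_subset_def closedin_metric
  proof (intro conjI allI impI sublevel_subset)
    fix a assume a: "a \<in> carrier (Lp TYPE('k) M p) - sublevel E r"
    then obtain f where f: "f \<in> V" "a = cls f" by (auto elim!: Lp.carrierE)
    have r: "S E f - r > 0" using a f cls_in_sublevel_iff[OF f(1) E] by auto
    have "b \<notin> sublevel E r" if b: "b \<in> mball a (S E f - r)" for b
    proof -
      obtain g where g: "g \<in> V" "b = cls g" using b by (auto elim!: Lp.carrierE)
      have "S E f \<le> S E (\<lambda>x. f x - g x) + S E g"
        using S_triangle[OF Fun.V_diff[OF f(1) g(1)] g(1) E] by simp
      also have "S E (\<lambda>x. f x - g x) < S E f - r"
        using b S_mono[OF Fun.V_diff[OF f(1) g(1)] E] by (simp add: f g ndist_cls)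
      finally show ?thesis using g cls_in_sublevel_iff[OF g(1) E] by auto
    qed
    then show "\<exists>s>0. disjnt (sublevel E r) (mball a s)"
      using r by (intro exI[of _ "S E f - r"]) (auto simp: disjnt_def)
  qed
qed

lemma convex_sublevel:
  assumes E: "E \<in> sets M"
  shows "convex_subset (Lp TYPE('k) M p) (sublevel E r)"
proof -
  have "add (Lp TYPE('k) M p) (scale (Lp TYPE('k) M p) (of_real (1 - t)) a)
      (scale (Lp TYPE('k) M p) (of_real t) b) \<in> sublevel E r"
    if a: "a \<in> sublevel E r" and b: "b \<in> sublevel E r" and t: "t \<in> {0..1}" for a b t
  proof -
    obtain f where f: "f \<in> V" "a = cls f" "S E f \<le> r"
      using a unfolding sublevel_def by blast
    obtain g where g: "g \<in> V" "b = cls g" "S E g \<le> r"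
      using b unfolding sublevel_def by blast
    let ?f = "\<lambda>x. of_real (1 - t) * f x" and ?g = "\<lambda>x. of_real t * g x"
    have V: "?f \<in> V" "?g \<in> V" using Fun.V_scale f(1) g(1) by blast+
    have "S E (\<lambda>x. ?f x + ?g x) \<le> (1 - t) * S E f + t * S E g"
      using S_triangle[OF V E] t unfolding S_scale norm_of_real by simp
    also have "\<dots> \<le> (1 - t) * r + t * r"
      using t f g by (intro add_mono mult_left_mono) auto
    also have "\<dots> = r" by (simp add: algebra_simps)
    finally have "cls (\<lambda>x. ?f x + ?g x) \<in> sublevel E r"
      using cls_in_sublevel_iff[OF Fun.V_add[OF V] E] by blast
    moreover have "add (Lp TYPE('k) M p) (scale (Lp TYPE('k) M p) (of_real (1 - t)) a)
        (scale (Lp TYPE('k) M p) (of_real t) b) = cls (\<lambda>x. ?f x + ?g x)"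
      using V f g by (simp only: Lp.map_scale Lp.map_add)
    ultimately show ?thesis by simp
  qed
  then show ?thesis
    unfolding convex_subset_def using sublevel_subset by blast
qed

end

subsection \<open>Disjoint sets carrying \<open>L_p\<close> functions\<close>

text \<open>A countable base reduces the dichotomy to one exceptional null set, off which all points
  of \<open>S\<close> lie in the same basic sets after applying \<open>h\<close>. Points of the
  codomain are determined by the basic sets containing them.\<close>

lemma AE_constant:
  fixes h :: "'a \<Rightarrow> 'b::{second_countable_topology, t2_space}"
  assumes dichotomy: "\<And>U. open U \<Longrightarrow>
    (AE x in M. x \<in> S \<longrightarrow> h x \<notin> U) \<or> (AE x in M. x \<in> S \<longrightarrow> h x \<in> U)"
  shows "\<exists>c. AE x in M. x \<in> S \<longrightarrow> h x = c"
proof (cases "AE x in M. x \<notin> S")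
  case True
  then show ?thesis by (auto elim: eventually_mono)
next
  case False
  obtain B :: "'b set set" where B: "countable B" "topological_basis B"
    using ex_countable_basis by blast
  have "\<exists>v. AE x in M. x \<in> S \<longrightarrow> (h x \<in> b) = v" if "b \<in> B" for b
    using dichotomy[OF topological_basis_open[OF B(2) that]]
  proof
    assume "AE x in M. x \<in> S \<longrightarrow> h x \<notin> b" then show ?thesis by (intro exI[of _ False]) simp
  next
    assume "AE x in M. x \<in> S \<longrightarrow> h x \<in> b" then show ?thesis by (intro exI[of _ True]) simp
  qed
  then obtain v where v: "\<And>b. b \<in> B \<Longrightarrow> AE x in M. x \<in> S \<longrightarrow> (h x \<in> b) = v b" by metis
  then have ae: "AE x in M. \<forall>b\<in>B. x \<in> S \<longrightarrow> (h x \<in> b) = v b"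
    unfolding AE_ball_countable[OF B(1)] by blast
  \<comment> \<open>Without such a point almost every point would lie outside \<open>S\<close>,
    which the current case excludes.\<close>
  have "\<exists>x0\<in>S. \<forall>b\<in>B. (h x0 \<in> b) = v b"
  proof (rule ccontr)
    assume none: "\<not> ?thesis"
    from ae have "AE x in M. x \<notin> S" by eventually_elim (use none in blast)
    with False show False ..
  qed
  then obtain x0 where x0: "x0 \<in> S" "\<forall>b\<in>B. (h x0 \<in> b) = v b" by blast
  have "y = h x0" if y: "\<forall>b\<in>B. (y \<in> b) = v b" for y
  proof (rule ccontr)
    assume "y \<noteq> h x0"
    then obtain U where U: "open U" "y \<in> U" "h x0 \<notin> U" using separation_t1 by blast
    then obtain b where "b \<in> B" "y \<in> b" "b \<subseteq> U"
      using B(2) topological_basisE by blast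
    then show False using y x0 U by blast
  qed
  then have "AE x in M. x \<in> S \<longrightarrow> h x = h x0"
    using ae by (auto elim: eventually_mono)
  then show ?thesis ..
qed

context Lp_exponent
begin

lemma V_restrict: "f \<in> V \<Longrightarrow> E \<in> sets M \<Longrightarrow> (\<lambda>x. indicator E x * f x) \<in> V"
  by (rule V_dominated[of f]) (auto simp: V_iff indicator_def intro!: borel_measurable_times borel_measurable_indicator)

text \<open>Expressed by functions rather than by the measure of \<open>E\<close>, because what the
  covering needs is a non-null vector of \<open>V\<close> living on \<open>E\<close>.\<close>

definition nontrivial :: "'a set \<Rightarrow> bool" where
  "nontrivial E \<longleftrightarrow> E \<in> sets M \<and> (\<exists>f\<in>V. \<not> (AE x in M. x \<in> E \<longrightarrow> f x = 0))"

text \<open>Finite dimension of \<open>L_p\<close> over \<open>E\<close>, stated with functions on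
  the whole space and equality almost everywhere on \<open>E\<close>, so that different sets can be
  compared without restricting the measure.\<close>

definition finitely_spanned :: "'a set \<Rightarrow> bool" where
  "finitely_spanned E \<longleftrightarrow> (\<exists>N f. (\<forall>j<N. f j \<in> V) \<and>
     (\<forall>g\<in>V. \<exists>c. AE x in M. x \<in> E \<longrightarrow> g x = (\<Sum>j<N::nat. c j * f j x)))"

lemma finite_dim_if_finitely_spanned:
  assumes "finitely_spanned (space M)"
  shows "finite_dim (Lp TYPE('k) M p)"
proof -
  obtain N :: nat and f where f: "\<And>j. j < N \<Longrightarrow> f j \<in> V"
    and span: "\<And>g. g \<in> V \<Longrightarrow> \<exists>c. AE x in M. x \<in> space M \<longrightarrow> g x = (\<Sum>j<N. c j * f j x)"
    using assms unfolding finitely_spanned_def by blast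
  have "\<exists>c. cls g = cls (\<lambda>x. \<Sum>j<N. c j * f j x)" if g: "g \<in> V" for g
  proof -
    obtain c where "AE x in M. x \<in> space M \<longrightarrow> g x = (\<Sum>j<N. c j * f j x)"
      using span[OF g] by blast
    then have "AE x in M. g x = (\<Sum>j<N. c j * f j x)" using AE_space by eventually_elim simp
    moreover have "(\<lambda>x. \<Sum>j<N. c j * f j x) \<in> V" using f by (intro Fun.V_sum) auto
    ultimately show ?thesis using g cls_eq_iff by blast
  qed
  then show ?thesis unfolding Lp.finite_dim_iff using f by blast
qed

text \<open>The generators for \<open>A\<close> are cut off to \<open>A\<close> and those for
  \<open>B\<close> to \<open>B - A\<close>. As the two groups have disjoint supports, the
  coefficient lists can be concatenated.\<close>

lemma finitely_spanned_Un:
  assumes A: "finitely_spanned A" "A \<in> sets M" and B: "finitely_spanned B" "B \<in> sets M"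
  shows "finitely_spanned (A \<union> B)"
proof -
  obtain N :: nat and f where f: "\<And>j. j < N \<Longrightarrow> f j \<in> V"
    and span_f: "\<And>g. g \<in> V \<Longrightarrow> \<exists>c. AE x in M. x \<in> A \<longrightarrow> g x = (\<Sum>j<N. c j * f j x)"
    using A unfolding finitely_spanned_def by blast
  obtain K :: nat and h where h: "\<And>j. j < K \<Longrightarrow> h j \<in> V"
    and span_h: "\<And>g. g \<in> V \<Longrightarrow> \<exists>c. AE x in M. x \<in> B \<longrightarrow> g x = (\<Sum>j<K. c j * h j x)"
    using B unfolding finitely_spanned_def by blast
  define w where "w j = (if j < N then (\<lambda>x. indicator A x * f j x)
    else (\<lambda>x. indicator (B - A) x * h (j - N) x))" for j
  have w: "w j \<in> V" if "j < N + K" for j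
    using that f h A(2) B(2) by (auto simp: w_def intro!: V_restrict)
  have split: "(\<Sum>j<N + K. u j) = (\<Sum>j<N. u j) + (\<Sum>j<K. u (N + j))" for u :: "nat \<Rightarrow> 'k"
    by (induction K) (simp_all add: add.assoc)
  have "\<exists>e. AE x in M. x \<in> A \<union> B \<longrightarrow> g x = (\<Sum>j<N + K. e j * w j x)" if g: "g \<in> V" for g
  proof -
    obtain c where c: "AE x in M. x \<in> A \<longrightarrow> g x = (\<Sum>j<N. c j * f j x)" using span_f[OF g] by blast
    obtain d where d: "AE x in M. x \<in> B \<longrightarrow> g x = (\<Sum>j<K. d j * h j x)" using span_h[OF g] by blast
    define e where "e j = (if j < N then c j else d (j - N))" for j
    have "AE x in M. x \<in> A \<union> B \<longrightarrow> g x = (\<Sum>j<N + K. e j * w j x)"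
      using c d
    proof eventually_elim
      case (elim x)
      then show ?case by (cases "x \<in> A") (auto simp: split e_def w_def)
    qed
    then show ?thesis by blast
  qed
  then show ?thesis unfolding finitely_spanned_def using w by blast
qed

text \<open>
  If \<open>A\<close> could not be split, it would behave like an atom: the quotient of two \<open>L_p\<close> functions
  would be constant on it, so \<open>A\<close> would be spanned by a single function.
\<close>

lemma nontrivial_split:
  assumes A: "A \<in> sets M" "\<not> finitely_spanned A"
  shows "\<exists>B\<subseteq>A. nontrivial B \<and> nontrivial (A - B)"
proof (rule ccontr)
  assume none: "\<not> ?thesis"
  have atom: "(\<forall>g\<in>V. AE x in M. x \<in> B \<longrightarrow> g x = 0) \<or> (\<forall>g\<in>V. AE x in M. x \<in> A - B \<longrightarrow> g x = 0)"
    if "B \<subseteq> A" "B \<in> sets M" for B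
  proof -
    have "\<not> nontrivial B \<or> \<not> nontrivial (A - B)" using none that(1) by blast
    moreover have "A - B \<in> sets M" using A(1) that(2) by blast
    ultimately show ?thesis using that(2) unfolding nontrivial_def by blast
  qed
  \<comment> \<open>With \<open>N = 0\<close> the sum is empty, so a set on which all functions of
    \<open>V\<close> vanish would be finitely spanned.\<close>
  have "\<exists>f\<in>V. \<not> (AE x in M. x \<in> A \<longrightarrow> f x = 0)"
    using A(2) unfolding finitely_spanned_def by (auto dest!: spec[of _ "0::nat"])
  then obtain f where f: "f \<in> V" "\<not> (AE x in M. x \<in> A \<longrightarrow> f x = 0)" by blast
  have meas_f: "f \<in> borel_measurable M" using f by (simp add: V_iff)
  have multiple: "\<exists>c. AE x in M. x \<in> A \<longrightarrow> g x = c * f x" if g: "g \<in> V" for g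
  proof -
    have meas_g: "g \<in> borel_measurable M" using g by (simp add: V_iff)
    \<comment> \<open>On \<open>T\<close> the quotient \<open>g / f\<close> is meaningful. The
      dichotomy for \<open>T\<close> cannot make \<open>f\<close> vanish on \<open>T\<close>, so
      every function of \<open>V\<close> vanishes on the rest of \<open>A\<close>.\<close>
    define T where "T = {x \<in> A. f x \<noteq> 0}"
    have "{x \<in> space M. f x \<noteq> 0} \<in> sets M" using meas_f by measurable
    moreover have "T = A \<inter> {x \<in> space M. f x \<noteq> 0}"
      using sets.sets_into_space[OF A(1)] by (auto simp: T_def)
    ultimately have T: "T \<in> sets M" "T \<subseteq> A" using A(1) by auto
    have "\<not> (AE x in M. x \<in> T \<longrightarrow> f x = 0)"
    proof
      assume "AE x in M. x \<in> T \<longrightarrow> f x = 0"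
      then have "AE x in M. x \<in> A \<longrightarrow> f x = 0" by eventually_elim (auto simp: T_def)
      with f(2) show False ..
    qed
    then have outside: "AE x in M. x \<in> A - T \<longrightarrow> g x = 0" using atom[OF T(2,1)] f(1) g by blast
    have "\<exists>c. AE x in M. x \<in> T \<longrightarrow> g x / f x = c"
    proof (rule AE_constant)
      fix U :: "'k set" assume U: "open U"
      define B where "B = {x \<in> T. g x / f x \<in> U}"
      have "(\<lambda>x. g x / f x) -` U \<inter> space M \<in> sets M"
        using meas_f meas_g U by (intro measurable_sets[of _ M borel] borel_measurable_divide) auto
      moreover have "B = T \<inter> ((\<lambda>x. g x / f x) -` U \<inter> space M)"
        using sets.sets_into_space[OF T(1)] by (auto simp: B_def)
      ultimately have B: "B \<in> sets M" "B \<subseteq> A" using T by auto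
      \<comment> \<open>Each alternative is tested on \<open>f\<close>, which has no zero in
        \<open>T\<close>: vanishing almost everywhere on \<open>B\<close> or on \<open>A - B\<close>
        means that this piece of \<open>T\<close> is null.\<close>
      from atom[OF B(2,1)]
      show "(AE x in M. x \<in> T \<longrightarrow> g x / f x \<notin> U) \<or> (AE x in M. x \<in> T \<longrightarrow> g x / f x \<in> U)"
      proof
        assume "\<forall>g\<in>V. AE x in M. x \<in> B \<longrightarrow> g x = 0"
        then have "AE x in M. x \<in> B \<longrightarrow> f x = 0" using f(1) by blast
        then have "AE x in M. x \<in> T \<longrightarrow> g x / f x \<notin> U"
          by eventually_elim (auto simp: B_def T_def)
        then show ?thesis ..
      next
        assume "\<forall>g\<in>V. AE x in M. x \<in> A - B \<longrightarrow> g x = 0"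
        then have "AE x in M. x \<in> A - B \<longrightarrow> f x = 0" using f(1) by blast
        then have "AE x in M. x \<in> T \<longrightarrow> g x / f x \<in> U"
          by eventually_elim (auto simp: B_def T_def)
        then show ?thesis ..
      qed
    qed
    then obtain c where "AE x in M. x \<in> T \<longrightarrow> g x / f x = c" by blast
    with outside have "AE x in M. x \<in> A \<longrightarrow> g x = c * f x"
    proof eventually_elim
      case (elim x)
      then show ?case by (cases "f x = 0") (auto simp: T_def)
    qed
    then show ?thesis by blast
  qed
  have "\<forall>g\<in>V. \<exists>c. AE x in M. x \<in> A \<longrightarrow> g x = (\<Sum>j<Suc 0. c j * f x)"
  proof (intro ballI)
    fix g assume "g \<in> V"
    then obtain c where "AE x in M. x \<in> A \<longrightarrow> g x = c * f x"
      using multiple by blast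
    then show "\<exists>c. AE x in M. x \<in> A \<longrightarrow> g x = (\<Sum>j<Suc 0. c j * f x)"
      by (intro exI[of _ "\<lambda>_. c"]) simp
  qed
  then have "finitely_spanned A"
    unfolding finitely_spanned_def using f(1) by (intro exI[of _ "Suc 0"] exI[of _ "\<lambda>_. f"]) blast
  with A(2) show False ..
qed

text \<open>By \<open>finitely_spanned_Un\<close> at least one half of a splitting is not finitely
  spanned. That half is kept for further splitting, and the other is a nontrivial piece.\<close>

lemma not_finitely_spanned_split:
  assumes A: "A \<in> sets M" "\<not> finitely_spanned A"
  shows "\<exists>B. B \<in> sets M \<and> \<not> finitely_spanned B \<and> B \<subseteq> A \<and> nontrivial (A - B)"
proof -
  obtain B where B: "B \<subseteq> A" "nontrivial B" "nontrivial (A - B)"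
    using nontrivial_split[OF A] by blast
  have sets: "B \<in> sets M" "A - B \<in> sets M" using B by (auto simp: nontrivial_def)
  have eq: "B \<union> (A - B) = A" "A - (A - B) = B" using B(1) by auto
  have "\<not> finitely_spanned B \<or> \<not> finitely_spanned (A - B)"
    using finitely_spanned_Un[of B "A - B"] sets A(2) eq(1) by auto
  then show ?thesis using B sets eq(2) by (metis Diff_subset)
qed

text \<open>Splitting repeatedly, starting from the whole space, gives a decreasing sequence; the
  pieces removed at successive stages are disjoint.\<close>

lemma disjoint_nontrivial_sequence:
  assumes "\<not> finite_dim (Lp TYPE('k) M p)"
  obtains D :: "nat \<Rightarrow> 'a set" where "disjoint_family D" "\<And>i. nontrivial (D i)"
proof -
  have "\<exists>A. \<forall>i. (A i \<in> sets M \<and> \<not> finitely_spanned (A i)) \<and> (A (Suc i) \<subseteq> A i \<and> nontrivial (A i - A (Suc i)))"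
  proof (rule dependent_nat_choice)
    show "\<exists>A. A \<in> sets M \<and> \<not> finitely_spanned A"
      using assms finite_dim_if_finitely_spanned by (intro exI[of _ "space M"]) auto
  qed (use not_finitely_spanned_split in blast)
  then obtain A where A: "\<And>i. A (Suc i) \<subseteq> A i" "\<And>i. nontrivial (A i - A (Suc i))" by blast
  have anti: "A j \<subseteq> A i" if "i \<le> j" for i j
    using that A(1) by (rule lift_Suc_antimono_le[rotated])
  have "(A i - A (Suc i)) \<inter> (A j - A (Suc j)) = {}" if "i < j" for i j
    using anti[of "Suc i" j] that by auto
  then have "disjoint_family (\<lambda>i. A i - A (Suc i))"
    unfolding disjoint_family_on_def by (metis inf_commute nat_neq_iff)
  then show ?thesis using that A(2) by blast
qed

subsection \<open>The covering\<close>

text \<open>The codimension of \<open>Y\<close> is finite but arbitrary, hence an infinite sequence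
  \<open>E\<close> inside \<open>F\<close>: it supplies enough independent vectors supported in
  \<open>F\<close> for a combination of them to fall into \<open>Y\<close>.\<close>

lemma essential_inradius_le:
  assumes F: "F \<in> sets M" and E: "disjoint_family E" "\<And>i::nat. nontrivial (E i)" "\<And>i. E i \<subseteq> F"
    and A: "A \<subseteq> sublevel F r"
  shows "essential_inradius (Lp TYPE('k) M p) A \<le> ennreal r"
  unfolding essential_inradius_def
proof (rule Sup_least, clarify)
  let ?X = "Lp TYPE('k) M p"
  fix s :: real and a Y
  assume s: "s > 0" and a: "a \<in> A" and Y: "subspace_of Y ?X" and fin: "finite_dim (quotient_space ?X Y)"
    and ball: "{add ?X a (scale ?X (of_real s) y) |y. y \<in> unit_ball ?X \<inter> Y} \<subseteq> A"
  obtain u where u: "u \<in> V" "a = cls u" using a A by (auto simp: sublevel_def)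
  interpret Q: function_surjection V "quotient_space ?X Y" "coset ?X Y \<circ> cls"
    by (rule Lp.quotient[OF Y])
  have "\<forall>i. \<exists>g\<in>V. \<not> (AE x in M. x \<in> E i \<longrightarrow> g x = 0)" using E(2) by (simp add: nontrivial_def)
  then obtain g0 where g0: "\<And>i. g0 i \<in> V" "\<And>i. \<not> (AE x in M. x \<in> E i \<longrightarrow> g0 i x = 0)" by metis
  \<comment> \<open>Cutting off to the disjoint sets \<open>E i\<close> prevents cancellation
    between different indices.\<close>
  define g where "g i x = indicator (E i) x * g0 i x" for i x
  have g: "g i \<in> V" for i
    using V_restrict[OF g0(1), of "E i"] E(2) by (simp add: g_def[abs_def] nontrivial_def)
  obtain N :: nat and c where c: "\<exists>i\<le>N. c i \<noteq> 0"
    and dep: "(coset ?X Y \<circ> cls) (\<lambda>x. \<Sum>i\<le>N. c i * g i x) = zero (quotient_space ?X Y)"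
    using Q.finite_dim_dependent[OF fin g] .
  define h where "h x = (\<Sum>i\<le>N. c i * g i x)" for x
  have h: "h \<in> V" unfolding h_def[abs_def] using g by (intro Fun.V_sum) auto
  have "coset ?X Y (cls h) = Y"
    using dep by (simp add: h_def[abs_def] quotient_space_def)
  then have hY: "cls h \<in> Y" using Lp.coset_map_eq_self_iff[OF Y h] by simp
  have h_outside: "h x = 0" if "x \<notin> F" for x
  proof -
    have "x \<notin> E i" for i using that E(3) by blast
    then show ?thesis by (simp add: h_def g_def)
  qed
  \<comment> \<open>Since \<open>h\<close> vanishes off \<open>F\<close>, its norm is fully seen by
    the seminorm over \<open>F\<close>. After normalization, \<open>y\<close> lies in the unit ball
    and still has seminorm 1 over \<open>F\<close>.\<close>
  have S_h: "S (space M) h = S F h"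
  proof -
    have "(\<lambda>x. indicator (space M) x * norm (h x) powr p) = (\<lambda>x. indicator F x * norm (h x) powr p)"
      using h_outside sets.sets_into_space[OF F] by (auto simp: indicator_def fun_eq_iff)
    then show ?thesis by (simp only: Lp_seminorm_def)
  qed
  \<comment> \<open>On a set \<open>E i\<close> with \<open>c i \<noteq> 0\<close> only the term of
    index \<open>i\<close> survives, and it is not null there.\<close>
  have "S F h \<noteq> 0"
  proof
    assume "S F h = 0"
    then have ae: "AE x in M. x \<in> F \<longrightarrow> h x = 0" using S_eq_0_iff[OF h F] by simp
    obtain i where i: "i \<le> N" "c i \<noteq> 0" using c by blast
    have "h x = c i * g0 i x" if x: "x \<in> E i" for x
    proof -
      have "x \<notin> E j" if "j \<noteq> i" for j
        using E(1) x that by (auto simp: disjoint_family_on_def)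
      then have "h x = (\<Sum>j\<le>N. if j = i then c i * g0 i x else 0)"
        unfolding h_def g_def using x by (intro sum.cong) auto
      then show ?thesis using i by simp
    qed
    with ae have "AE x in M. x \<in> E i \<longrightarrow> g0 i x = 0"
      using i E(3) by (auto elim!: eventually_mono)
    with g0(2) show False by blast
  qed
  then have pos: "S F h > 0" using S_nonneg[of F h] by linarith
  define y where "y x = of_real (1 / S F h) * h x" for x
  have y: "y \<in> V" unfolding y_def[abs_def] using h by (rule Fun.V_scale)
  have yY: "cls y \<in> Y" unfolding y_def[abs_def] by (rule Lp.map_scale_in[OF Y h hY])
  have S_y: "S F y = 1" "S (space M) y = 1"
    unfolding y_def[abs_def] S_scale S_h norm_of_real using pos by auto
  have shift: "S F (\<lambda>x. u x + of_real s * z x) \<le> r"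
    if z: "z \<in> V" "cls z \<in> Y" "S (space M) z \<le> 1" for z
  proof -
    have "cls z \<in> unit_ball ?X"
      using z by (simp add: unit_ball_eq cls_in_sublevel_iff)
    then have "add ?X a (scale ?X (of_real s) (cls z)) \<in> A" using z(2) ball by blast
    then have "cls (\<lambda>x. u x + of_real s * z x) \<in> sublevel F r"
      using A u z(1) Fun.V_scale[OF z(1)] by (auto simp: Lp.map_scale Lp.map_add)
    then show ?thesis
      using cls_in_sublevel_iff[OF Fun.V_add[OF u(1) Fun.V_scale[OF z(1)]] F] by blast
  qed
  \<comment> \<open>Both \<open>y\<close> and \<open>-y\<close> are admissible directions. The two
    shifted points differ by \<open>2 s y\<close>, whose seminorm over \<open>F\<close> is
    \<open>2 s\<close>, while the triangle inequality bounds it by \<open>2 r\<close>; the centre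
    \<open>u\<close> cancels.\<close>
  let ?plus = "\<lambda>x. u x + of_real s * y x" and ?minus = "\<lambda>x. u x + of_real s * (-1 * y x)"
  have "S F ?plus \<le> r" using y yY S_y by (intro shift) auto
  moreover have "S F ?minus \<le> r"
  proof (rule shift)
    show "(\<lambda>x. -1 * y x) \<in> V" using y by (rule Fun.V_scale)
    show "cls (\<lambda>x. -1 * y x) \<in> Y" using Lp.map_scale_in[OF Y y yY] .
    show "S (space M) (\<lambda>x. -1 * y x) \<le> 1" unfolding S_scale using S_y by simp
  qed
  moreover have "?plus \<in> V"
    by (intro Fun.V_add Fun.V_scale u(1) y)
  moreover have "?minus \<in> V"
    by (intro Fun.V_add Fun.V_scale u(1) y)
  ultimately have le: "S F ?plus \<le> r" "S F ?minus \<le> r" "?plus \<in> V" "?minus \<in> V" by auto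
  then have "S F (\<lambda>x. ?plus x - ?minus x) \<le> S F ?plus + S F ?minus" by (intro S_diff F)
  moreover have "(\<lambda>x. ?plus x - ?minus x) = (\<lambda>x. of_real (2 * s) * y x)" by (simp add: algebra_simps)
  ultimately have "S F (\<lambda>x. of_real (2 * s) * y x) \<le> 2 * r" using le by simp
  then have "s \<le> r" unfolding S_scale norm_of_real S_y using s by simp
  then show "ennreal s \<le> ennreal r" by (rule ennreal_leI)
qed

theorem covering_index_le:
  assumes "\<not> finite_dim (Lp TYPE('k) M p)" and n: "1 \<le> n"
  shows "covering_index (Lp TYPE('k) M p) n \<le> ennreal (real n powr (- (1 / p)))"
proof -
  let ?X = "Lp TYPE('k) M p"
  obtain D :: "nat \<Rightarrow> 'a set" where D: "disjoint_family D" "\<And>i. nontrivial (D i)"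
    using disjoint_nontrivial_sequence[OF assms(1)] by blast
  \<comment> \<open>The pairing function splits one disjoint sequence into infinitely many families,
    each of them infinite; the first \<open>n\<close> from index 1 on are used.\<close>
  define E where "E k m = D (prod_encode (k, m))" for k m
  define F where "F k = (\<Union>m. E k m)" for k
  define r where "r = real n powr (- (1 / p))"
  define A where "A k = sublevel (space M) 1 \<inter> sublevel (F k) r" for k
  have F: "F k \<in> sets M" for k
    using D(2) unfolding F_def E_def nontrivial_def by (intro sets.countable_UN) auto
  have disj: "disjoint_family F"
    using D(1) unfolding disjoint_family_on_def F_def E_def
    by (auto simp: set_eq_iff) (metis prod_encode_eq prod.inject)
  have "r powr p = real n powr (- 1)" using p by (simp add: r_def powr_powr)
  then have r: "0 \<le> r" "r powr p = 1 / real n"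
    using n by (auto simp: r_def powr_minus_divide)
  have "A k \<in> closed_convex_bounded ?X" for k
    unfolding closed_convex_bounded_def
  proof (intro CollectI conjI)
    show "closed_subset ?X (A k)"
      unfolding A_def closed_subset_def using closed_sublevel[OF sets.top] closed_sublevel[OF F]
      by (intro closedin_Int) (auto simp: closed_subset_def)
    show "convex_subset ?X (A k)"
      using convex_sublevel[OF sets.top, of 1] convex_sublevel[OF F, of k r]
      unfolding A_def convex_subset_def by blast
    show "bounded_subset ?X (A k)"
      using sublevel_subset unfolding A_def bounded_subset_def unit_ball_eq[symmetric]
      by (auto simp: unit_ball_def intro!: exI[of _ 1])
  qed
  moreover have "unit_ball ?X = (\<Union>k\<in>{1..n}. A k)"
  proof
    show "(\<Union>k\<in>{1..n}. A k) \<subseteq> unit_ball ?X" by (auto simp: A_def unit_ball_eq)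
    show "unit_ball ?X \<subseteq> (\<Union>k\<in>{1..n}. A k)"
    proof
      fix a assume a: "a \<in> unit_ball ?X"
      then obtain f where f: "f \<in> V" "a = cls f" "S (space M) f \<le> 1"
        by (auto simp: unit_ball_eq sublevel_def)
      let ?I = "\<lambda>E. \<integral>x. indicator E x * norm (f x) powr p \<partial>M"
      \<comment> \<open>Pigeonhole on \<open>p\<close>-th powers: as
        \<open>r powr p = 1 / n\<close>, failure for all \<open>k\<close> would make the integrals
        over the disjoint sets \<open>F k\<close> add up to more than 1, against the norm bound on
        \<open>f\<close>.\<close>
      have "\<exists>k\<in>{1..n}. S (F k) f \<le> r"
      proof (rule ccontr)
        assume "\<not> ?thesis"
        then have "1 / real n < ?I (F k)" if "k \<in> {1..n}" for k
          using that by (auto simp: S_le_iff[OF r(1)] r(2) not_le)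
        then have "(\<Sum>k\<in>{1..n}. 1 / real n) < (\<Sum>k\<in>{1..n}. ?I (F k))"
          using n by (intro sum_strict_mono) auto
        also have "\<dots> = (\<integral>x. (\<Sum>k\<in>{1..n}. indicator (F k) x * norm (f x) powr p) \<partial>M)"
          by (intro Bochner_Integration.integral_sum[symmetric] integrable_restrict f(1) F)
        also have "\<dots> = ?I (\<Union>k\<in>{1..n}. F k)"
          unfolding sum_distrib_right[symmetric]
          by (subst indicator_UN_disjoint) (auto intro: disjoint_family_on_mono[OF _ disj])
        also have "\<dots> \<le> ?I (space M)"
          using F by (intro integral_mono integrable_restrict f(1)) (auto simp: indicator_def)
        also have "\<dots> \<le> 1" using f(3) S_le_iff[of 1 "space M" f] by simp
        finally show False using n by simp
      qed
      then show "a \<in> (\<Union>k\<in>{1..n}. A k)"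
        using f F by (auto simp: A_def cls_in_sublevel_iff)
    qed
  qed
  ultimately have "covering_index ?X n \<le> (MAX k\<in>{1..n}. essential_inradius ?X (A k))"
    unfolding covering_index_def by (intro Inf_lower) blast
  also have "\<dots> \<le> ennreal r"
  proof (rule Max.boundedI)
    fix t assume "t \<in> (\<lambda>k. essential_inradius ?X (A k)) ` {1..n}"
    then obtain k where t: "t = essential_inradius ?X (A k)" by blast
    have "disjoint_family (E k)"
      using D(1) unfolding disjoint_family_on_def E_def by simp
    then show "t \<le> ennreal r"
      unfolding t using D(2) F by (intro essential_inradius_le[of "F k" "E k"]) (auto simp: F_def E_def A_def)
  qed (use n in auto)
  finally show ?thesis by (simp add: r_def)
qed

end

theorem proposition3p1:
  fixes M :: "'a measure" and p :: real and n :: nat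
  assumes "1 \<le> p" and "sigma_finite_measure M" and "1 \<le> n"
  shows "(\<not> finite_dim (Lp TYPE(real) M p) \<longrightarrow>
            covering_index (Lp TYPE(real) M p) n \<le> ennreal (real n powr (- (1 / p)))) \<and>
         (\<not> finite_dim (Lp TYPE(complex) M p) \<longrightarrow>
            covering_index (Lp TYPE(complex) M p) n \<le> ennreal (real n powr (- (1 / p))))"
  \<comment> \<open>The real and the complex case are two instances of the same locale
    theorem.\<close>
  by (intro conjI impI; rule Lp_exponent.covering_index_le[OF Lp_exponent.intro[OF assms(1)] _ assms(3)])

end
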